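(* Let $(H;\langle\cdot,\cdot\rangle)$ be an inner product space over the real or complex number field $\mathbb{K}$, let $n\ge2$ be an integer and let $x_i\in H$ for $i\in\{1,\dots,n\}$. Then $$\Big(\sum_{i=1}^n\|x_i\|\Big)^2\le\Big\|\sum_{i=1}^n x_i\Big\|^2+\frac{n(n-1)}{2}\Big(\sum_{k=1}^{n-1}\|\Delta x_k\|\Big)^2.$$ The constant $\frac12$ is best possible in the sense that it cannot be replaced in general by a smaller quantity: if $H\ne\{0\}$ and $c>0$ is a constant such that $$\Big(\sum_{i=1}^n\|x_i\|\Big)^2\le\Big\|\sum_{i=1}^n x_i\Big\|^2+c\,n(n-1)\Big(\sum_{k=1}^{n-1}\|\Delta x_k\|\Big)^2$$ for all $n\ge2$ and all $x_1,\dots,x_n\in H$, then $c\ge\frac12$.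
   Context: $\|\cdot\|$ is the norm induced by the inner product, and $\Delta x_k:=x_{k+1}-x_k$ for $1\le k\le n-1$ denotes the forward difference. *)

theory Defs
  imports "HOL-Analysis.Analysis"
begin

text \<open>
  Real inner product spaces are the library class \<^class>\<open>real_inner\<close>. The library has no complex
  counterpart, so it is defined here on top of \<^locale>\<open>vector_space\<close>. The inner product is linear in
  its first argument and conjugate-linear in its second. Real-valuedness of \<open>\<langle>x, x\<rangle>\<close> follows from
  conjugate symmetry.
\<close>

locale complex_inner_space = vector_space scale
  for scale :: "complex \<Rightarrow> 'a::ab_group_add \<Rightarrow> 'a" +
  fixes cinner :: "'a \<Rightarrow> 'a \<Rightarrow> complex"
  assumes cinner_commute: "cinner x y = cnj (cinner y x)"
    and cinner_add_left: "cinner (x + y) z = cinner x z + cinner y z"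
    and cinner_scale_left: "cinner (scale a x) y = a * cinner x y"
    and cinner_ge_zero: "0 \<le> Re (cinner x x)"
    and cinner_eq_zero_iff: "cinner x x = 0 \<longleftrightarrow> x = 0"

text \<open>
  The library's \<^const>\<open>norm\<close> is tied to \<^class>\<open>real_normed_vector\<close>; for real inner product spaces it is
  the induced norm by \<open>norm_eq_sqrt_inner\<close>.
\<close>

definition cinner_norm :: "('a \<Rightarrow> 'a \<Rightarrow> complex) \<Rightarrow> 'a \<Rightarrow> real"
  where "cinner_norm ip x = sqrt (Re (ip x x))"

lemma complex_inner_space_complex: "complex_inner_space (*) (\<lambda>x y. x * cnj y)"
  by unfold_locales (auto simp: algebra_simps)

definition fwd_diff :: "(nat \<Rightarrow> 'a::minus) \<Rightarrow> nat \<Rightarrow> 'a"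
  where "fwd_diff x k = x (k + 1) - x k"

end

theory Submission
  imports Defs
begin

text \<open>
  Expanding squared norms gives
  \<open>(\<Sum>i. \<parallel>x i\<parallel>)\<^sup>2 - \<parallel>\<Sum>i. x i\<parallel>\<^sup>2 = \<Sum>i,j. (\<parallel>x i\<parallel> \<parallel>x j\<parallel> - Re \<langle>x i, x j\<rangle>)\<close>.
  The diagonal terms vanish, and since \<open>(\<parallel>u\<parallel> - \<parallel>v\<parallel>)\<^sup>2 \<ge> 0\<close>, each of the \<open>n (n - 1)\<close>
  off-diagonal terms is at most \<open>\<parallel>x i - x j\<parallel>\<^sup>2 / 2\<close>. Telescoping and the triangle inequality bound
  \<open>\<parallel>x i - x j\<parallel>\<close> by the total variation \<open>\<Sum>k. \<parallel>\<Delta> x k\<parallel>\<close>. The estimate for pairwise distances is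
  \<open>sum_norm_square_le\<close>, and the telescoping bound is \<open>norm_diff_le_variation\<close>.

  The constant is attained with two vectors: for \<open>x 1 = h\<close> and \<open>x 2 = - h\<close> the inequality with
  constant \<open>c\<close> reads \<open>4 \<parallel>h\<parallel>\<^sup>2 \<le> 8 c \<parallel>h\<parallel>\<^sup>2\<close>.

  Only \<open>Re \<langle>x, y\<rangle>\<close> enters the argument, so the complex case reduces to the real one by restriction
  of scalars. The proof is therefore carried out in a locale of real inner products that covers
  both.
\<close>

text \<open>
  The scalar multiplication is a parameter because the complex inner product spaces under
  consideration live on types without a \<^class>\<open>real_vector\<close> instance. Its purpose is to form the
  combination of two vectors in the proof of the Cauchy-Schwarz inequality, for which compatibility
  with the inner product suffices.
\<close>

locale real_inner_product =
  fixes scl :: "real \<Rightarrow> 'a::ab_group_add \<Rightarrow> 'a" and g :: "'a \<Rightarrow> 'a \<Rightarrow> real"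
  assumes commute: "g x y = g y x"
    and add_left: "g (x + y) z = g x z + g y z"
    and scl_left: "g (scl a x) y = a * g x y"
    and nonneg: "0 \<le> g x x"
    and definite: "g x x = 0 \<Longrightarrow> x = 0"
begin

definition nrm :: "'a \<Rightarrow> real"
  where "nrm x = sqrt (g x x)"

lemma additive_left: "Modules.additive (\<lambda>x. g x z)"
  by unfold_locales (rule add_left)

lemma zero_left: "g 0 z = 0"
  by (rule Modules.additive.zero[OF additive_left])

lemma minus_left: "g (- x) z = - g x z"
  by (rule Modules.additive.minus[OF additive_left])

lemma diff_left: "g (x - y) z = g x z - g y z"
  by (rule Modules.additive.diff[OF additive_left])

lemma sum_left: "g (sum f A) z = (\<Sum>i\<in>A. g (f i) z)"
  by (rule Modules.additive.sum[OF additive_left])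

lemma add_right: "g z (x + y) = g z x + g z y"
  by (metis add_left commute)

lemma diff_right: "g z (x - y) = g z x - g z y"
  by (metis diff_left commute)

lemma scl_right: "g z (scl a x) = a * g z x"
  by (metis scl_left commute)

lemma sum_right: "g z (sum f A) = (\<Sum>i\<in>A. g z (f i))"
  using sum_left[of f A z] by (simp add: commute)

lemma nrm_nonneg: "0 \<le> nrm x"
  by (simp add: nrm_def nonneg)

lemma nrm_square: "(nrm x)\<^sup>2 = g x x"
  by (simp add: nrm_def nonneg)

lemma nrm_zero: "nrm 0 = 0"
  by (simp add: nrm_def zero_left)

lemma nrm_minus: "nrm (- x) = nrm x"
  unfolding nrm_def by (metis minus_left commute minus_minus)

lemma nrm_minus_commute: "nrm (x - y) = nrm (y - x)"
  by (metis nrm_minus minus_diff_eq)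

lemma nrm_pos: "x \<noteq> 0 \<Longrightarrow> 0 < nrm x"
  using definite[of x] nonneg[of x] by (auto simp: nrm_def less_le)

lemma Cauchy_Schwarz: "g x y \<le> nrm x * nrm y"
proof (cases "y = 0")
  case True
  then show ?thesis
    by (simp add: nrm_zero zero_left commute[of x])
next
  case False
  then have pos: "0 < g y y"
    using definite[of y] nonneg[of y] by (auto simp: less_le)
  \<comment> \<open>Up to a scalar, this vector is the component of \<open>x\<close> orthogonal to \<open>y\<close>; clearing the
    denominator avoids a division.\<close>
  define z where "z = scl (g y y) x - scl (g x y) y"
  have "g z z = g y y * (g y y * g x x - (g x y)\<^sup>2)"
    unfolding z_def
    by (simp add: diff_left diff_right scl_left scl_right commute[of y x]
        power2_eq_square algebra_simps)
  then have "0 \<le> g y y * g x x - (g x y)\<^sup>2"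
    using nonneg[of z] pos by (simp add: zero_le_mult_iff)
  then have "(g x y)\<^sup>2 \<le> (nrm x * nrm y)\<^sup>2"
    by (simp add: power_mult_distrib nrm_square mult.commute)
  then show ?thesis
    by (rule power2_le_imp_le) (simp add: nrm_nonneg)
qed

lemma nrm_triangle: "nrm (x + y) \<le> nrm x + nrm y"
proof (rule power2_le_imp_le)
  have "(nrm (x + y))\<^sup>2 = (nrm x)\<^sup>2 + 2 * g x y + (nrm y)\<^sup>2"
    by (simp add: nrm_square add_left add_right commute[of y x])
  also have "\<dots> \<le> (nrm x + nrm y)\<^sup>2"
    using Cauchy_Schwarz[of x y] by (simp add: power2_sum)
  finally show "(nrm (x + y))\<^sup>2 \<le> (nrm x + nrm y)\<^sup>2" .
qed (simp add: nrm_nonneg)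

lemma nrm_sum: "nrm (sum f A) \<le> (\<Sum>i\<in>A. nrm (f i))"
proof (induction A rule: infinite_finite_induct)
  case (insert a A)
  then show ?case
    using nrm_triangle[of "f a" "sum f A"] by simp
qed (simp_all add: nrm_zero)

text \<open>
  The two sides differ by exactly \<open>(\<parallel>x\<parallel> - \<parallel>y\<parallel>)\<^sup>2 / 2\<close>.
\<close>

lemma Cauchy_Schwarz_defect_le: "nrm x * nrm y - g x y \<le> (nrm (x - y))\<^sup>2 / 2"
proof -
  have "(nrm (x - y))\<^sup>2 = (nrm x)\<^sup>2 - 2 * g x y + (nrm y)\<^sup>2"
    by (simp add: nrm_square diff_left diff_right commute[of y x])
  moreover have "2 * (nrm x * nrm y) \<le> (nrm x)\<^sup>2 + (nrm y)\<^sup>2"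
    using sum_squares_bound[of "nrm x" "nrm y"] by (simp add: mult.assoc)
  ultimately show ?thesis
    by simp
qed

text \<open>
  Expanding both squares as double sums leaves the Cauchy-Schwarz defects of the ordered pairs.
  Dropping the pairs on the diagonal, where the defect vanishes, is what produces the factor
  \<open>n (n - 1)\<close> instead of \<open>n\<^sup>2\<close>.
\<close>

lemma sum_norm_square_le:
  assumes "finite A" and d: "\<And>i j. i \<in> A \<Longrightarrow> j \<in> A \<Longrightarrow> nrm (x i - x j) \<le> d"
  shows "(\<Sum>i\<in>A. nrm (x i))\<^sup>2
    \<le> (nrm (\<Sum>i\<in>A. x i))\<^sup>2 + real (card A) * (real (card A) - 1) / 2 * d\<^sup>2"
proof -
  have defect: "nrm (x i) * nrm (x j) - g (x i) (x j) \<le> (if j = i then 0 else d\<^sup>2 / 2)"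
    if "i \<in> A" "j \<in> A" for i j
  proof (cases "j = i")
    case True
    then show ?thesis
      by (simp add: nrm_square flip: power2_eq_square)
  next
    case False
    then show ?thesis
      using Cauchy_Schwarz_defect_le[of "x i" "x j"] power_mono[OF d[OF that] nrm_nonneg, of 2]
      by simp
  qed
  have row: "(\<Sum>j\<in>A. if j = i then 0 else d\<^sup>2 / 2) = (real (card A) - 1) * (d\<^sup>2 / 2)"
    if "i \<in> A" for i
  proof -
    have "1 \<le> card A"
      using that \<open>finite A\<close> by (metis One_nat_def Suc_leI card_gt_0_iff empty_iff)
    then show ?thesis
      using that \<open>finite A\<close> by (simp add: sum.remove of_nat_diff)
  qed
  have "(nrm (\<Sum>i\<in>A. x i))\<^sup>2 = (\<Sum>i\<in>A. \<Sum>j\<in>A. g (x i) (x j))"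
    unfolding nrm_square sum_left by (simp only: sum_right)
  then have "(\<Sum>i\<in>A. nrm (x i))\<^sup>2 - (nrm (\<Sum>i\<in>A. x i))\<^sup>2
      = (\<Sum>i\<in>A. \<Sum>j\<in>A. nrm (x i) * nrm (x j) - g (x i) (x j))"
    by (simp add: power2_eq_square[of "\<Sum>i\<in>A. nrm (x i)"] sum_product sum_subtractf)
  also have "\<dots> \<le> (\<Sum>i\<in>A. \<Sum>j\<in>A. if j = i then 0 else d\<^sup>2 / 2)"
    by (intro sum_mono defect)
  also have "\<dots> = real (card A) * ((real (card A) - 1) * (d\<^sup>2 / 2))"
    by (simp add: row)
  finally show ?thesis
    by simp
qed

lemma norm_diff_le_variation:
  assumes "i \<in> {1..n}" "j \<in> {1..n}"
  shows "nrm (x i - x j) \<le> (\<Sum>k=1..n-1. nrm (fwd_diff x k))"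
proof -
  have ordered: "nrm (x b - x a) \<le> (\<Sum>k=1..n-1. nrm (fwd_diff x k))"
    if "1 \<le> a" "a \<le> b" "b \<le> n" for a b
  proof -
    have "x b - x a = (\<Sum>k=a..<b. fwd_diff x k)"
      using sum_Suc_diff'[OF \<open>a \<le> b\<close>, of x] by (simp add: fwd_diff_def)
    then have "nrm (x b - x a) \<le> (\<Sum>k=a..<b. nrm (fwd_diff x k))"
      by (simp add: nrm_sum)
    also have "\<dots> \<le> (\<Sum>k=1..n-1. nrm (fwd_diff x k))"
      using that by (intro sum_mono2) (auto simp: nrm_nonneg)
    finally show ?thesis .
  qed
  show ?thesis
    using assms ordered[of i j] ordered[of j i] nrm_minus_commute[of "x i" "x j"]
    by (cases "i \<le> j") auto
qed

lemma sum_norm_square_le_variation: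
  "(\<Sum>i=1..n. nrm (x i))\<^sup>2
    \<le> (nrm (\<Sum>i=1..n. x i))\<^sup>2
      + real n * (real n - 1) / 2 * (\<Sum>k=1..n-1. nrm (fwd_diff x k))\<^sup>2"
  using sum_norm_square_le[of "{1..n}" x, OF _ norm_diff_le_variation] by simp

lemma variation_constant_ge_half:
  fixes h :: 'a
  assumes "h \<noteq> 0"
    and bound: "\<And>n (x :: nat \<Rightarrow> 'a). 2 \<le> n \<Longrightarrow> (\<Sum>i=1..n. nrm (x i))\<^sup>2
      \<le> (nrm (\<Sum>i=1..n. x i))\<^sup>2
        + c * real n * (real n - 1) * (\<Sum>k=1..n-1. nrm (fwd_diff x k))\<^sup>2"
  shows "1 / 2 \<le> c"
proof -
  define x where "x i = (if i = 1 then h else - h)" for i :: nat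
  have two: "{Suc 0..2} = {1, 2}"
    by auto
  have "(nrm (- h - h))\<^sup>2 = 4 * (nrm h)\<^sup>2"
    using nrm_minus[of "h + h"] by (simp add: nrm_square add_left add_right)
  moreover have "(2 * nrm h)\<^sup>2 \<le> 2 * c * (nrm (- h - h))\<^sup>2"
    using bound[of 2 x] by (simp add: two x_def fwd_diff_def nrm_zero nrm_minus)
  ultimately have "4 * (nrm h)\<^sup>2 \<le> (8 * c) * (nrm h)\<^sup>2"
    by (simp add: power_mult_distrib)
  then show ?thesis
    using nrm_pos[OF \<open>h \<noteq> 0\<close>] by simp
qed

end

lemma real_inner_product_inner:
  "real_inner_product scaleR (inner :: 'a::real_inner \<Rightarrow> 'a \<Rightarrow> real)"
  by unfold_locales (auto simp: inner_add_left intro: inner_commute)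

text \<open>
  Conjugate symmetry makes \<open>\<langle>x, x\<rangle>\<close> real, so taking real parts loses neither the norm nor
  definiteness.
\<close>

lemma real_inner_product_Re:
  fixes scale :: "complex \<Rightarrow> 'a::ab_group_add \<Rightarrow> 'a"
  assumes "complex_inner_space scale ip"
  shows "real_inner_product (\<lambda>r. scale (complex_of_real r)) (\<lambda>x y. Re (ip x y))"
proof -
  interpret complex_inner_space scale ip
    by (fact assms)
  show ?thesis
  proof
    show "Re (ip x y) = Re (ip y x)" for x y
      by (metis cinner_commute complex_cnj cnj.simps(1))
    show "x = 0" if "Re (ip x x) = 0" for x
    proof -
      have "Im (ip x x) = 0"
        using arg_cong[OF cinner_commute[of x x], of Im] by simp
      then show ?thesis
        using that cinner_eq_zero_iff[of x] by (simp add: complex_eq_iff)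
    qed
  qed (simp_all add: cinner_add_left cinner_scale_left cinner_ge_zero)
qed

theorem corollary1:
  shows
    "((\<forall>n\<ge>2. \<forall>x :: nat \<Rightarrow> 'a::real_inner.
        (\<Sum>i=1..n. norm (x i))^2
          \<le> (norm (\<Sum>i=1..n. x i))^2
             + real n * (real n - 1) / 2 * (\<Sum>k=1..n-1. norm (fwd_diff x k))^2)
      \<and> ((\<exists>h::'a. h \<noteq> 0) \<longrightarrow>
        (\<forall>c::real. c > 0 \<longrightarrow>
          (\<forall>n\<ge>2. \<forall>x :: nat \<Rightarrow> 'a.
            (\<Sum>i=1..n. norm (x i))^2
              \<le> (norm (\<Sum>i=1..n. x i))^2
                 + c * real n * (real n - 1) * (\<Sum>k=1..n-1. norm (fwd_diff x k))^2)
          \<longrightarrow> c \<ge> 1/2)))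
   \<and> (\<forall>(scale :: complex \<Rightarrow> 'b::ab_group_add \<Rightarrow> 'b) ip. complex_inner_space scale ip \<longrightarrow>
      (\<forall>n\<ge>2. \<forall>x :: nat \<Rightarrow> 'b.
        (\<Sum>i=1..n. cinner_norm ip (x i))^2
          \<le> (cinner_norm ip (\<Sum>i=1..n. x i))^2
             + real n * (real n - 1) / 2 * (\<Sum>k=1..n-1. cinner_norm ip (fwd_diff x k))^2)
      \<and> ((\<exists>h::'b. h \<noteq> 0) \<longrightarrow>
        (\<forall>c::real. c > 0 \<longrightarrow>
          (\<forall>n\<ge>2. \<forall>x :: nat \<Rightarrow> 'b.
            (\<Sum>i=1..n. cinner_norm ip (x i))^2
              \<le> (cinner_norm ip (\<Sum>i=1..n. x i))^2
                 + c * real n * (real n - 1) * (\<Sum>k=1..n-1. cinner_norm ip (fwd_diff x k))^2)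
          \<longrightarrow> c \<ge> 1/2)))"
proof (intro conjI allI impI)
  interpret real_inner_product scaleR "inner :: 'a \<Rightarrow> 'a \<Rightarrow> real"
    by (rule real_inner_product_inner)
  have nrm: "nrm = norm"
    by (simp add: fun_eq_iff nrm_def norm_eq_sqrt_inner)
  show "(\<Sum>i=1..n. norm (x i))^2
      \<le> (norm (\<Sum>i=1..n. x i))^2
        + real n * (real n - 1) / 2 * (\<Sum>k=1..n-1. norm (fwd_diff x k))^2"
    for n and x :: "nat \<Rightarrow> 'a"
    using sum_norm_square_le_variation[of x n] unfolding nrm .
  show "1 / 2 \<le> c"
    if "\<exists>h::'a. h \<noteq> 0"
      and "\<forall>n\<ge>2. \<forall>x :: nat \<Rightarrow> 'a. (\<Sum>i=1..n. norm (x i))^2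
        \<le> (norm (\<Sum>i=1..n. x i))^2
          + c * real n * (real n - 1) * (\<Sum>k=1..n-1. norm (fwd_diff x k))^2"
    for c
    using that variation_constant_ge_half[of _ c] unfolding nrm by blast
next
  fix scale :: "complex \<Rightarrow> 'b \<Rightarrow> 'b" and ip
  assume "complex_inner_space scale ip"
  then interpret real_inner_product "\<lambda>r. scale (complex_of_real r)" "\<lambda>x y. Re (ip x y)"
    by (rule real_inner_product_Re)
  have nrm: "nrm = cinner_norm ip"
    by (simp add: fun_eq_iff nrm_def cinner_norm_def)
  show "(\<Sum>i=1..n. cinner_norm ip (x i))^2
      \<le> (cinner_norm ip (\<Sum>i=1..n. x i))^2
        + real n * (real n - 1) / 2 * (\<Sum>k=1..n-1. cinner_norm ip (fwd_diff x k))^2"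
    for n and x :: "nat \<Rightarrow> 'b"
    using sum_norm_square_le_variation[of x n] unfolding nrm .
  show "1 / 2 \<le> c"
    if "\<exists>h::'b. h \<noteq> 0"
      and "\<forall>n\<ge>2. \<forall>x :: nat \<Rightarrow> 'b. (\<Sum>i=1..n. cinner_norm ip (x i))^2
        \<le> (cinner_norm ip (\<Sum>i=1..n. x i))^2
          + c * real n * (real n - 1) * (\<Sum>k=1..n-1. cinner_norm ip (fwd_diff x k))^2"
    for c
    using that variation_constant_ge_half[of _ c] unfolding nrm by blast
qed

end
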